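(* For all functions $Z:\mathbb{N}^2\to\mathbb{K}^d$, all bounds $\boldsymbol{\ell},\boldsymbol{r}\in\mathbb{N}^2$ and all matrix compositions $\mathbf{a},\mathbf{b}\in\mathrm{Cmp}$, $$\langle \mathsf{SS}_{\boldsymbol{\ell};\boldsymbol{r}}(Z),\mathbf{a}\rangle\,\langle \mathsf{SS}_{\boldsymbol{\ell};\boldsymbol{r}}(Z),\mathbf{b}\rangle=\langle \mathsf{SS}_{\boldsymbol{\ell};\boldsymbol{r}}(Z),\mathbf{a}\ast\mathbf{b}\rangle,$$ where $\ast$ is the two-parameter quasi-shuffle product.
   Context: $\mathbb{K}$ is an integral domain, $\mathbb{N}=\{1,2,\ldots\}$, $d\in\mathbb{N}$ is fixed. $(\mathfrak{M}_d,\star,\varepsilon)$ is the free commutative monoid generated by $d$ letters $\mathbf{1},\ldots,\mathbf{d}$. A non-empty matrix composition is a matrix $\mathbf{a}\in\mathfrak{M}_d^{m\times n}$ ($m,n\geq1$) such that no row and no column consists only of entries $\varepsilon$. $\mathrm{Cmp}$ is the set of all these matrices together with an additional element $\mathsf{e}$, the empty composition (with zero rows and columns). $\mathsf{rows}(\mathbf{a})$, $\mathsf{cols}(\mathbf{a})$ are the numbers of rows and columns. $\mathrm{diag}(\mathbf{a},\mathbf{b})$ is the block diagonal matrix with blocks $\mathbf{a}$, $\mathbf{b}$ and all other entries $\varepsilon$ (blocks need not be square). $\mathbb{K}\langle\mathrm{Cmp}_{\mathrm{con}}\rangle$ denotes the free $\mathbb{K}$-module with basis $\mathrm{Cmp}$.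 For $z\in\mathbb{K}^d$, $\lambda\mapsto z^{(\lambda)}$ is the monoid homomorphism from $\mathfrak{M}_d$ to the multiplicative monoid of $\mathbb{K}$ with $z^{(\mathbf{j})}=z_j$ for every letter $\mathbf{j}$. The two-parameter sums signature $\mathsf{SS}_{\boldsymbol{\ell};\boldsymbol{r}}(Z)$ is the function $\mathrm{Cmp}\to\mathbb{K}$ (extended linearly to $\mathbb{K}\langle\mathrm{Cmp}_{\mathrm{con}}\rangle$, written as a pairing) given by $$\langle\mathsf{SS}_{\boldsymbol{\ell};\boldsymbol{r}}(Z),\mathbf{a}\rangle=\sum_{\substack{\boldsymbol{\ell}_1<\iota_1<\cdots<\iota_{\mathsf{rows}(\mathbf{a})}\leq\boldsymbol{r}_1\\ \boldsymbol{\ell}_2<\kappa_1<\cdots<\kappa_{\mathsf{cols}(\mathbf{a})}\leq\boldsymbol{r}_2}}\ \prod_{s=1}^{\mathsf{rows}(\mathbf{a})}\prod_{t=1}^{\mathsf{cols}(\mathbf{a})}Z_{\iota_s,\kappa_t}^{(\mathbf{a}_{s,t})},$$ with $\langle\mathsf{SS}_{\boldsymbol{\ell};\boldsymbol{r}}(Z),\mathsf{e}\rangle=1$. For $m,s,j\in\mathbb{N}$, $\mathrm{qSh}(m,s;j)$ is the set of surjections $q:\{1,\ldots,m+s\}\to\{1,\ldots,j\}$ with $q(1)<\cdots<q(m)$ and $q(m+1)<\cdots<q(m+s)$. The two-parameter quasi-shuffle product $\ast$ on $\mathbb{K}\langle\mathrm{Cmp}_{\mathrm{con}}\rangle$ is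 the bilinear map with $\mathsf{e}$ as neutral element and, for non-empty compositions $\mathbf{a}\in\mathfrak{M}_d^{m\times n}$, $\mathbf{b}\in\mathfrak{M}_d^{s\times t}$, $$\mathbf{a}\ast\mathbf{b}=\sum_{j,k\in\mathbb{N}}\ \sum_{p\in\mathrm{qSh}(m,s;j),\ q\in\mathrm{qSh}(n,t;k)}\mathbf{c}^{p,q},\qquad \mathbf{c}^{p,q}\in\mathfrak{M}_d^{j\times k},\quad \mathbf{c}^{p,q}_{x,y}=\bigstar_{u\in p^{-1}(x),\,v\in q^{-1}(y)}\mathrm{diag}(\mathbf{a},\mathbf{b})_{u,v}.$$ *)

theory Defs
  imports
    "HOL-Library.Poly_Mapping"
    "HOL-Library.FuncSet"
    "HOL-Library.Multiset"
    "Jordan_Normal_Form.Matrix"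
begin

text \<open>
  The \<open>d\<close> letters are the elements of a finite type \<open>'d\<close>. The free commutative monoid on them is
  \<^typ>\<open>'d multiset\<close>, written additively: the product of letters is \<open>+\<close>, the unit is \<open>{#}\<close>.
  Rows, columns and positions in index tuples are counted from \<open>0\<close>, as in \<^typ>\<open>'a mat\<close>.
\<close>

definition is_composition :: "'d multiset mat \<Rightarrow> bool" where
  "is_composition A \<longleftrightarrow> A = 0\<^sub>m 0 0 \<or>
     (1 \<le> dim_row A \<and> 1 \<le> dim_col A \<and>
      (\<forall>i<dim_row A. \<exists>j<dim_col A. A $$ (i, j) \<noteq> {#}) \<and>
      (\<forall>j<dim_col A. \<exists>i<dim_row A. A $$ (i, j) \<noteq> {#}))"

typedef 'd cmp = "{A :: 'd multiset mat. is_composition A}"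
  morphisms mat_of_cmp cmp_of_mat
  by (rule exI[of _ "0\<^sub>m 0 0"]) (simp add: is_composition_def)

definition empty_cmp :: "'d cmp" where
  "empty_cmp = cmp_of_mat (0\<^sub>m 0 0)"

definition cmp_rows :: "'d cmp \<Rightarrow> nat" where
  "cmp_rows a = dim_row (mat_of_cmp a)"

definition cmp_cols :: "'d cmp \<Rightarrow> nat" where
  "cmp_cols a = dim_col (mat_of_cmp a)"

definition diag2 :: "'d multiset mat \<Rightarrow> 'd multiset mat \<Rightarrow> 'd multiset mat" where
  "diag2 A B = four_block_mat A (0\<^sub>m (dim_row A) (dim_col B)) (0\<^sub>m (dim_row B) (dim_col A)) B"

definition monoid_eval :: "('d \<Rightarrow> 'k::comm_monoid_mult) \<Rightarrow> 'd multiset \<Rightarrow> 'k" where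
  "monoid_eval z w = prod_mset (image_mset z w)"

definition increasing_tuples :: "nat \<Rightarrow> nat \<Rightarrow> nat \<Rightarrow> (nat \<Rightarrow> nat) set" where
  "increasing_tuples n l r = {\<iota> \<in> {..<n} \<rightarrow>\<^sub>E {l<..r}. strict_mono_on {..<n} \<iota>}"

text \<open>For the empty composition the sum below has a single, empty product, so its value is \<open>1\<close>
  (\<open>sums_signature_empty\<close>).\<close>

definition sums_signature ::
  "nat \<times> nat \<Rightarrow> nat \<times> nat \<Rightarrow> (nat \<times> nat \<Rightarrow> 'd \<Rightarrow> 'k::comm_ring_1) \<Rightarrow> 'd cmp \<Rightarrow> 'k" where
  "sums_signature l r Z a =
     (\<Sum>\<iota>\<in>increasing_tuples (cmp_rows a) (fst l) (fst r).
      \<Sum>\<kappa>\<in>increasing_tuples (cmp_cols a) (snd l) (snd r).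
      \<Prod>s<cmp_rows a. \<Prod>t<cmp_cols a. monoid_eval (Z (\<iota> s, \<kappa> t)) (mat_of_cmp a $$ (s, t)))"

text \<open>The free module with basis \<^typ>\<open>'d cmp\<close> is \<^typ>\<open>'d cmp \<Rightarrow>\<^sub>0 'k\<close>.\<close>

definition pairing :: "('b \<Rightarrow> 'k::comm_ring_1) \<Rightarrow> ('b \<Rightarrow>\<^sub>0 'k) \<Rightarrow> 'k" where
  "pairing f x = (\<Sum>a\<in>Poly_Mapping.keys x. Poly_Mapping.lookup x a * f a)"

definition qSh :: "nat \<Rightarrow> nat \<Rightarrow> nat \<Rightarrow> (nat \<Rightarrow> nat) set" where
  "qSh m s j = {q \<in> {..<m + s} \<rightarrow>\<^sub>E {..<j}. q ` {..<m + s} = {..<j} \<and>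
     strict_mono_on {..<m} q \<and> strict_mono_on {m..<m + s} q}"

definition quasi_shuffle_mat ::
  "'d multiset mat \<Rightarrow> 'd multiset mat \<Rightarrow> nat \<Rightarrow> nat \<Rightarrow> (nat \<Rightarrow> nat) \<Rightarrow> (nat \<Rightarrow> nat) \<Rightarrow> 'd multiset mat"
where
  "quasi_shuffle_mat A B j k p q = mat j k (\<lambda>(x, y).
     \<Sum>u\<in>{u. u < dim_row A + dim_row B \<and> p u = x}.
     \<Sum>v\<in>{v. v < dim_col A + dim_col B \<and> q v = y}. diag2 A B $$ (u, v))"

text \<open>The sums over \<open>j\<close> and \<open>k\<close> are truncated since \<open>qSh m s j\<close> is empty for \<open>j > m + s\<close>
  (\<open>qSh_empty\<close>). The matrices to which \<open>cmp_of_mat\<close> is applied are compositions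
  (\<open>is_composition_quasi_shuffle_mat\<close>).\<close>

definition quasi_shuffle_basis :: "'d cmp \<Rightarrow> 'd cmp \<Rightarrow> 'd cmp \<Rightarrow>\<^sub>0 'k::comm_ring_1" where
  "quasi_shuffle_basis a b =
     (if a = empty_cmp then Poly_Mapping.single b 1
      else if b = empty_cmp then Poly_Mapping.single a 1
      else \<Sum>j = 1..cmp_rows a + cmp_rows b. \<Sum>k = 1..cmp_cols a + cmp_cols b.
           \<Sum>p\<in>qSh (cmp_rows a) (cmp_rows b) j. \<Sum>q\<in>qSh (cmp_cols a) (cmp_cols b) k.
             Poly_Mapping.single
               (cmp_of_mat (quasi_shuffle_mat (mat_of_cmp a) (mat_of_cmp b) j k p q)) 1)"

definition quasi_shuffle ::
  "('d cmp \<Rightarrow>\<^sub>0 'k::comm_ring_1) \<Rightarrow> ('d cmp \<Rightarrow>\<^sub>0 'k) \<Rightarrow> ('d cmp \<Rightarrow>\<^sub>0 'k)" where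
  "quasi_shuffle x y =
     (\<Sum>a\<in>Poly_Mapping.keys x. \<Sum>b\<in>Poly_Mapping.keys y.
        Poly_Mapping.map ((*) (Poly_Mapping.lookup x a * Poly_Mapping.lookup y b))
          (quasi_shuffle_basis a b))"

lemma mat_of_empty_cmp: "mat_of_cmp empty_cmp = 0\<^sub>m 0 0"
  by (simp add: empty_cmp_def cmp_of_mat_inverse is_composition_def)

lemma sums_signature_empty: "sums_signature l r Z empty_cmp = 1"
proof -
  have "increasing_tuples 0 i j = {\<lambda>_. undefined}" for i j
    by (auto simp: increasing_tuples_def strict_mono_on_def)
  then show ?thesis
    by (simp add: sums_signature_def cmp_rows_def cmp_cols_def mat_of_empty_cmp)
qed

lemma qSh_empty:
  assumes "m + s < j"
  shows "qSh m s j = {}"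
proof -
  have False if "q \<in> qSh m s j" for q
  proof -
    have "q ` {..<m + s} = {..<j}" using that by (simp add: qSh_def)
    then have "j \<le> m + s" using card_image_le[of "{..<m + s}" q] by simp
    then show False using assms by simp
  qed
  then show ?thesis by blast
qed

lemma is_composition_quasi_shuffle_mat:
  assumes A: "is_composition A" "A \<noteq> 0\<^sub>m 0 0" and B: "is_composition B" "B \<noteq> 0\<^sub>m 0 0"
    and p: "p \<in> qSh (dim_row A) (dim_row B) j" and q: "q \<in> qSh (dim_col A) (dim_col B) k"
  shows "is_composition (quasi_shuffle_mat A B j k p q)"
proof -
  let ?D = "diag2 A B" and ?m = "dim_row A + dim_row B" and ?n = "dim_col A + dim_col B"
  have row: "\<exists>v<?n. ?D $$ (u, v) \<noteq> {#}" if u: "u < ?m" for u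
  proof (cases "u < dim_row A")
    case True
    then obtain v where "v < dim_col A" "A $$ (u, v) \<noteq> {#}"
      using A by (auto simp: is_composition_def)
    with True u show ?thesis
      by (intro exI[of _ v]) (simp add: diag2_def)
  next
    case False
    then have "u - dim_row A < dim_row B" using u by simp
    then obtain v where "v < dim_col B" "B $$ (u - dim_row A, v) \<noteq> {#}"
      using B by (auto simp: is_composition_def)
    with False u show ?thesis
      by (intro exI[of _ "dim_col A + v"]) (simp add: diag2_def)
  qed
  have col: "\<exists>u<?m. ?D $$ (u, v) \<noteq> {#}" if v: "v < ?n" for v
  proof (cases "v < dim_col A")
    case True
    then obtain u where "u < dim_row A" "A $$ (u, v) \<noteq> {#}"
      using A by (auto simp: is_composition_def)
    with True v show ?thesis
      by (intro exI[of _ u]) (simp add: diag2_def)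
  next
    case False
    then have "v - dim_col A < dim_col B" using v by simp
    then obtain u where "u < dim_row B" "B $$ (u, v - dim_col A) \<noteq> {#}"
      using B by (auto simp: is_composition_def)
    with False v show ?thesis
      by (intro exI[of _ "dim_row A + u"]) (simp add: diag2_def)
  qed
  have pim: "p ` {..<?m} = {..<j}" and qim: "q ` {..<?n} = {..<k}"
    using p q by (auto simp: qSh_def)
  have entry: "quasi_shuffle_mat A B j k p q $$ (p u, q v) \<noteq> {#}"
    if "u < ?m" "v < ?n" "?D $$ (u, v) \<noteq> {#}" for u v
  proof -
    have "p u < j" "q v < k" using that pim qim by auto
    moreover have "(\<Sum>u'\<in>{u'. u' < ?m \<and> p u' = p u}. \<Sum>v'\<in>{v'. v' < ?n \<and> q v' = q v}.
        ?D $$ (u', v')) \<noteq> {#}"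
      using that by (auto simp: sum_eq_empty_iff)
    ultimately show ?thesis by (simp add: quasi_shuffle_mat_def)
  qed
  have dims: "dim_row (quasi_shuffle_mat A B j k p q) = j"
    "dim_col (quasi_shuffle_mat A B j k p q) = k"
    by (simp_all add: quasi_shuffle_mat_def)
  have "1 \<le> ?m" "1 \<le> ?n" using A by (auto simp: is_composition_def)
  then have "0 \<in> {..<?m}" "0 \<in> {..<?n}" by auto
  then have "p 0 \<in> {..<j}" "q 0 \<in> {..<k}"
    unfolding pim[symmetric] qim[symmetric] by - (rule imageI, assumption)+
  then have "1 \<le> j" "1 \<le> k" by auto
  moreover have "\<exists>y<k. quasi_shuffle_mat A B j k p q $$ (x, y) \<noteq> {#}" if "x < j" for x
  proof -
    have "x \<in> p ` {..<?m}" unfolding pim using that by simp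
    then obtain u where u: "u < ?m" "x = p u" by auto
    obtain v where v: "v < ?n" "?D $$ (u, v) \<noteq> {#}" using row[OF u(1)] by blast
    have "q v \<in> {..<k}" unfolding qim[symmetric] by (rule imageI) (simp add: v(1))
    then show ?thesis using entry[OF u(1) v] unfolding u(2) by (intro exI[of _ "q v"]) simp
  qed
  moreover have "\<exists>x<j. quasi_shuffle_mat A B j k p q $$ (x, y) \<noteq> {#}" if "y < k" for y
  proof -
    have "y \<in> q ` {..<?n}" unfolding qim using that by simp
    then obtain v where v: "v < ?n" "y = q v" by auto
    obtain u where u: "u < ?m" "?D $$ (u, v) \<noteq> {#}" using col[OF v(1)] by blast
    have "p u \<in> {..<j}" unfolding pim[symmetric] by (rule imageI) (simp add: u(1))
    then show ?thesis using entry[OF u(1) v(1) u(2)] unfolding v(2) by (intro exI[of _ "p u"]) simp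
  qed
  ultimately show ?thesis by (simp add: is_composition_def dims)
qed

lemma quasi_shuffle_single:
  "quasi_shuffle (Poly_Mapping.single a 1) (Poly_Mapping.single b 1) =
     (quasi_shuffle_basis a b :: 'd cmp \<Rightarrow>\<^sub>0 'k::comm_ring_1)"
proof -
  have 1: "Poly_Mapping.map ((*) (1::'k)) x = x" for x :: "'d cmp \<Rightarrow>\<^sub>0 'k"
  proof (rule poly_mapping_eqI)
    show "Poly_Mapping.lookup (Poly_Mapping.map ((*) 1) x) k = Poly_Mapping.lookup x k" for k
      unfolding Poly_Mapping.map.rep_eq mult_1_left when_def
      by (cases "Poly_Mapping.lookup x k = 0")
         (simp_all only: if_cancel if_True not_False_eq_True)
  qed
  show ?thesis
    by (simp only: quasi_shuffle_def keys_single lookup_single_eq one_neq_zero if_False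
        sum.insert finite.emptyI empty_iff not_False_eq_True sum.empty add_0_right mult_1_left 1)
qed

end

theory Submission
  imports Defs
begin

text \<open>
  Both sides are sums of monomials over index tuples, and the theorem says that two ways of
  indexing these sums agree.

  The left-hand side is a sum over pairs of row tuples \<open>(\<iota>, \<iota>')\<close> and pairs of column tuples
  \<open>(\<kappa>, \<kappa>')\<close>. Writing \<open>\<iota>'\<close> behind \<open>\<iota>\<close> gives one tuple of length \<open>m + s\<close>, increasing on each of its
  two blocks (\<open>block_tuples\<close>), and likewise for the columns. As the unit of the monoid evaluates
  to \<open>1\<close>, the product of the monomials of \<open>a\<close> and \<open>b\<close> is the monomial of the block diagonal matrix
  at the joint tuples (\<open>monomial_diag2\<close>).

  A tuple of two increasing blocks need not be increasing, but it takes its values in a unique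
  increasing order: it is \<open>\<tau> \<circ> p\<close> for exactly one \<open>j\<close>, one quasi-shuffle \<open>p\<close> onto \<open>j\<close> positions and
  one increasing \<open>\<tau>\<close> of length \<open>j\<close>, where \<open>\<tau>\<close> enumerates the set of values
  (\<open>bij_betw_quasi_shuffle_tuples\<close>). Positions that \<open>p\<close> identifies are evaluated at the same index,
  so that their letters may be multiplied before evaluation. Hence the monomial of the block
  diagonal matrix at \<open>\<tau> \<circ> p\<close>, \<open>\<sigma> \<circ> q\<close> is the monomial of the quasi-shuffled matrix at \<open>\<tau>\<close>, \<open>\<sigma>\<close>
  (\<open>monomial_quasi_shuffle_mat\<close>), and summation over all data gives the right-hand side.
  If \<open>a\<close> or \<open>b\<close> is empty, the product is defined separately, and the identity holds because the
  signature of the empty composition is \<open>1\<close>.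
\<close>

section \<open>Linearity of the pairing\<close>

lemma pairing_eq_sum_superset:
  assumes "finite S" "Poly_Mapping.keys x \<subseteq> S"
  shows "pairing f x = (\<Sum>a\<in>S. Poly_Mapping.lookup x a * f a)"
  unfolding pairing_def
  by (rule sum.mono_neutral_left) (use assms in \<open>auto simp: in_keys_iff\<close>)

lemma pairing_add: "pairing f (x + y) = pairing f x + pairing f y"
proof -
  let ?S = "Poly_Mapping.keys x \<union> Poly_Mapping.keys y"
  have "finite ?S" by simp
  moreover have "Poly_Mapping.keys (x + y) \<subseteq> ?S" by (rule keys_add)
  ultimately show ?thesis
    by (simp add: pairing_eq_sum_superset[of ?S] lookup_add distrib_right sum.distrib)
qed

lemma pairing_sum: "pairing f (\<Sum>i\<in>I. x i) = (\<Sum>i\<in>I. pairing f (x i))"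
proof (induction I rule: infinite_finite_induct)
  case (insert i I)
  then show ?case by (simp add: pairing_add)
qed (simp_all add: pairing_def)

lemma pairing_single_1: "pairing f (Poly_Mapping.single a 1) = f a"
  by (simp add: pairing_def)

section \<open>Tuples of two increasing blocks\<close>

definition block_tuples :: "nat \<Rightarrow> nat \<Rightarrow> nat \<Rightarrow> nat \<Rightarrow> (nat \<Rightarrow> nat) set" where
  "block_tuples m s l r = {g \<in> {..<m + s} \<rightarrow>\<^sub>E {l<..r}.
     strict_mono_on {..<m} g \<and> strict_mono_on {m..<m + s} g}"

definition append_tuple :: "nat \<Rightarrow> nat \<Rightarrow> (nat \<Rightarrow> nat) \<Rightarrow> (nat \<Rightarrow> nat) \<Rightarrow> nat \<Rightarrow> nat" where
  "append_tuple m s \<iota> \<iota>' = (\<lambda>u\<in>{..<m + s}. if u < m then \<iota> u else \<iota>' (u - m))"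

lemma bij_betw_append_tuple:
  "bij_betw (\<lambda>(\<iota>, \<iota>'). append_tuple m s \<iota> \<iota>')
     (increasing_tuples m l r \<times> increasing_tuples s l r) (block_tuples m s l r)"
proof (rule bij_betw_byWitness[where f' =
      "\<lambda>g. (restrict g {..<m}, \<lambda>u\<in>{..<s}. g (m + u))"])
  let ?I = "increasing_tuples m l r \<times> increasing_tuples s l r"
  show "\<forall>x\<in>?I. (\<lambda>g. (restrict g {..<m}, \<lambda>u\<in>{..<s}. g (m + u)))
      ((\<lambda>(\<iota>, \<iota>'). append_tuple m s \<iota> \<iota>') x) = x"
    by (auto simp: increasing_tuples_def append_tuple_def fun_eq_iff restrict_def
        PiE_def extensional_def)
  show "\<forall>g\<in>block_tuples m s l r. (\<lambda>(\<iota>, \<iota>'). append_tuple m s \<iota> \<iota>')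
      (restrict g {..<m}, \<lambda>u\<in>{..<s}. g (m + u)) = g"
    by (auto simp: block_tuples_def append_tuple_def fun_eq_iff restrict_def
        PiE_def extensional_def)
  show "(\<lambda>(\<iota>, \<iota>'). append_tuple m s \<iota> \<iota>') ` ?I \<subseteq> block_tuples m s l r"
  proof clarify
    fix \<iota> \<iota>' assume *: "\<iota> \<in> increasing_tuples m l r" "\<iota>' \<in> increasing_tuples s l r"
    have "u - m < s" if "u < m + s" "\<not> u < m" for u using that by linarith
    moreover have "v - m < s \<and> u - m < v - m" if "u < v" "v < m + s" "m \<le> u" for u v
      using that by linarith
    ultimately show "append_tuple m s \<iota> \<iota>' \<in> block_tuples m s l r"
      using * unfolding block_tuples_def append_tuple_def increasing_tuples_def
      by (auto simp: strict_mono_on_def PiE_iff)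
  qed
  show "(\<lambda>g. (restrict g {..<m}, \<lambda>u\<in>{..<s}. g (m + u))) ` block_tuples m s l r \<subseteq> ?I"
    by (auto simp: block_tuples_def increasing_tuples_def strict_mono_on_def PiE_iff)
qed

lemma sum_append_tuple:
  "(\<Sum>\<iota>\<in>increasing_tuples m l r. \<Sum>\<iota>'\<in>increasing_tuples s l r. F (append_tuple m s \<iota> \<iota>')) =
     (\<Sum>g\<in>block_tuples m s l r. F g)"
  unfolding sum.cartesian_product
  using sum.reindex_bij_betw[OF bij_betw_append_tuple, of F m s l r]
  by (simp add: case_prod_unfold)

text \<open>An increasing tuple is determined by its set of values: it lists them in order.\<close>

lemma map_increasing_eq_sorted_list:
  fixes \<tau> :: "nat \<Rightarrow> nat"
  assumes "strict_mono_on {..<j} \<tau>"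
  shows "map \<tau> [0..<j] = sorted_list_of_set (\<tau> ` {..<j})"
proof -
  have "sorted_wrt (<) (map \<tau> [0..<j])"
    using assms by (auto simp: sorted_wrt_iff_nth_less strict_mono_on_def)
  then have "sorted_list_of_set (set (map \<tau> [0..<j])) = map \<tau> [0..<j]"
    by (intro sorted_list_of_set.idem_if_sorted_distinct) (auto simp: strict_sorted_iff)
  then show ?thesis by (simp add: atLeast0LessThan)
qed

text \<open>
  Every tuple of two increasing blocks factors uniquely through the increasing enumeration of its
  values. Strictness within the blocks of \<open>p\<close> is inherited from \<open>g = \<tau> \<circ> p\<close> because \<open>\<tau>\<close> reflects the
  order, and \<open>p\<close> is onto because \<open>\<tau>\<close> takes no further values.
  Since \<open>j\<close> starts at \<open>1\<close>, the empty tuple, whose set of values is empty, has to be excluded.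
\<close>

lemma bij_betw_quasi_shuffle_tuples:
  assumes "0 < m + s"
  shows "bij_betw (\<lambda>(j, p, \<tau>). \<lambda>u\<in>{..<m + s}. \<tau> (p u))
     (SIGMA j : {1..m + s}. qSh m s j \<times> increasing_tuples j l r) (block_tuples m s l r)"
  unfolding bij_betw_def
proof
  let ?M = "m + s" and ?X = "SIGMA j : {1..m + s}. qSh m s j \<times> increasing_tuples j l r"
  let ?f = "\<lambda>(j, p, \<tau>). \<lambda>u\<in>{..<m + s}. \<tau> (p u)"
  show "inj_on ?f ?X"
  proof (rule inj_onI, unfold split_paired_all, elim SigmaE2, unfold case_prod_conv)
    fix j p \<tau> j' p' \<tau>'
    assume p: "p \<in> qSh m s j" and \<tau>: "\<tau> \<in> increasing_tuples j l r"
      and p': "p' \<in> qSh m s j'" and \<tau>': "\<tau>' \<in> increasing_tuples j' l r"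
      and eq: "(\<lambda>u\<in>{..<?M}. \<tau> (p u)) = (\<lambda>u\<in>{..<?M}. \<tau>' (p' u))"
    have eq': "\<tau> (p u) = \<tau>' (p' u)" if "u < ?M" for u
      using fun_cong[OF eq, of u] that by simp
    have "\<tau> ` {..<j} = (\<lambda>u. \<tau> (p u)) ` {..<?M}"
      using p by (auto simp: qSh_def image_image[symmetric])
    also have "\<dots> = (\<lambda>u. \<tau>' (p' u)) ` {..<?M}"
      using eq' by (auto intro!: image_cong)
    also have "\<dots> = \<tau>' ` {..<j'}"
      using p' by (auto simp: qSh_def image_image[symmetric])
    finally have "map \<tau> [0..<j] = map \<tau>' [0..<j']"
      using \<tau> \<tau>' by (simp add: increasing_tuples_def map_increasing_eq_sorted_list)
    then have j: "j = j'" and nth: "\<forall>i<j. \<tau> i = \<tau>' i"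
      by (auto simp: list_eq_iff_nth_eq)
    have "\<tau> = \<tau>'"
      using \<tau> \<tau>' nth unfolding j increasing_tuples_def by (auto intro: PiE_ext)
    moreover have "inj_on \<tau> {..<j}"
      using \<tau> by (auto simp: increasing_tuples_def intro: strict_mono_on_imp_inj_on)
    then have "p u = p' u" if "u < ?M" for u
      using eq'[OF that] that p p' unfolding \<open>\<tau> = \<tau>'\<close> j
      by (auto simp: qSh_def inj_on_def PiE_iff)
    then have "p = p'"
      using p p' unfolding j qSh_def by (auto intro: PiE_ext)
    ultimately show "(j, p, \<tau>) = (j', p', \<tau>')" using j by simp
  qed
  show "?f ` ?X = block_tuples m s l r"
  proof
    show "?f ` ?X \<subseteq> block_tuples m s l r"
    proof clarify
      fix j p \<tau> assume p: "p \<in> qSh m s j" and \<tau>: "\<tau> \<in> increasing_tuples j l r"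
      have "p u < j" if "u < ?M" for u using p that by (auto simp: qSh_def PiE_iff)
      then show "(\<lambda>u\<in>{..<?M}. \<tau> (p u)) \<in> block_tuples m s l r"
        using p \<tau> unfolding block_tuples_def qSh_def increasing_tuples_def
        by (auto simp: PiE_iff strict_mono_on_def)
    qed
    show "block_tuples m s l r \<subseteq> ?f ` ?X"
    proof
      fix g assume g: "g \<in> block_tuples m s l r"
      define S where "S = g ` {..<?M}"
      define \<tau> where "\<tau> = (\<lambda>i\<in>{..<card S}. sorted_list_of_set S ! i)"
      have "finite S" by (simp add: S_def)
      have \<tau>_mono: "strict_mono_on {..<card S} \<tau>"
        using strict_sorted_list_of_set[of S] \<open>finite S\<close>
        by (auto simp: strict_mono_on_def \<tau>_def sorted_wrt_iff_nth_less)
      have \<tau>_image: "\<tau> ` {..<card S} = S"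
      proof -
        have "\<tau> ` {..<card S} = set (sorted_list_of_set S)"
          using \<open>finite S\<close> by (auto simp: \<tau>_def set_conv_nth)
        then show ?thesis using \<open>finite S\<close> by simp
      qed
      have \<tau>: "\<tau> \<in> increasing_tuples (card S) l r"
      proof -
        have "S \<subseteq> {l<..r}" using g by (auto simp: S_def block_tuples_def PiE_iff)
        then have "\<tau> i \<in> {l<..r}" if "i < card S" for i using \<tau>_image that by blast
        then show ?thesis using \<tau>_mono
          by (auto simp: increasing_tuples_def PiE_iff) (simp add: \<tau>_def)
      qed
      define p where "p = (\<lambda>u\<in>{..<?M}. inv_into {..<card S} \<tau> (g u))"
      have \<tau>p: "\<tau> (p u) = g u" and p_lt: "p u < card S" if "u < ?M" for u
      proof -
        have "g u \<in> S" unfolding S_def using that by auto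
        then have "g u \<in> \<tau> ` {..<card S}" by (simp only: \<tau>_image)
        then show "\<tau> (p u) = g u" "p u < card S"
          using that f_inv_into_f[of "g u" \<tau> "{..<card S}"]
            inv_into_into[of "g u" \<tau> "{..<card S}"] by (simp_all add: p_def)
      qed
      have p_less: "p u < p v" if "u < ?M" "v < ?M" "g u < g v" for u v
        using strict_mono_on_less[OF \<tau>_mono, of "p u" "p v"] that by (simp add: \<tau>p p_lt)
      have "p ` {..<?M} = {..<card S}"
      proof
        show "{..<card S} \<subseteq> p ` {..<?M}"
        proof
          fix x assume x: "x \<in> {..<card S}"
          then obtain u where u: "u < ?M" "\<tau> x = g u" using \<tau>_image S_def by auto
          then have "\<tau> x = \<tau> (p u)" by (simp add: \<tau>p)
          then have "x = p u"
            using strict_mono_on_imp_inj_on[OF \<tau>_mono] x p_lt[OF u(1)] by (auto simp: inj_on_def)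
          then show "x \<in> p ` {..<?M}" using u(1) by auto
        qed
      qed (use p_lt in auto)
      then have p: "p \<in> qSh m s (card S)"
        using g p_lt p_less unfolding qSh_def block_tuples_def
        by (auto simp: PiE_iff strict_mono_on_def) (simp add: p_def)
      have "1 \<le> card S"
        using assms \<open>finite S\<close> by (simp add: S_def Suc_le_eq card_gt_0_iff lessThan_empty_iff)
      moreover have "card S \<le> ?M"
        unfolding S_def using card_image_le[of "{..<?M}" g] by simp
      moreover have "g = (\<lambda>u\<in>{..<?M}. \<tau> (p u))"
        using g \<tau>p by (auto simp: block_tuples_def fun_eq_iff PiE_iff extensional_def)
      ultimately show "g \<in> ?f ` ?X"
        using p \<tau> by (intro image_eqI[of _ _ "(card S, p, \<tau>)"]) auto
    qed
  qed
qed

lemma finite_qSh: "finite (qSh m s j)"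
  by (rule finite_subset[of _ "{..<m + s} \<rightarrow>\<^sub>E {..<j}"])
    (auto simp: qSh_def intro: finite_PiE)

lemma finite_increasing_tuples: "finite (increasing_tuples j l r)"
  by (rule finite_subset[of _ "{..<j} \<rightarrow>\<^sub>E {l<..r}"])
    (auto simp: increasing_tuples_def intro: finite_PiE)

lemma sum_block_tuples_eq_sum_quasi_shuffles:
  assumes "0 < m + s"
  shows "(\<Sum>g\<in>block_tuples m s l r. F g) =
     (\<Sum>j = 1..m + s. \<Sum>p\<in>qSh m s j. \<Sum>\<tau>\<in>increasing_tuples j l r. F (\<lambda>u\<in>{..<m + s}. \<tau> (p u)))"
  using sum.reindex_bij_betw[OF bij_betw_quasi_shuffle_tuples[OF assms, of l r], of F]
  by (simp add: sum.Sigma sum.cartesian_product finite_qSh finite_increasing_tuples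
      case_prod_unfold)

section \<open>Monomials of matrices\<close>

definition monomial ::
  "(nat \<times> nat \<Rightarrow> 'd \<Rightarrow> 'k::comm_monoid_mult) \<Rightarrow> 'd multiset mat \<Rightarrow> (nat \<Rightarrow> nat) \<Rightarrow> (nat \<Rightarrow> nat) \<Rightarrow> 'k"
where
  "monomial Z A \<iota> \<kappa> =
     (\<Prod>s<dim_row A. \<Prod>t<dim_col A. monoid_eval (Z (\<iota> s, \<kappa> t)) (A $$ (s, t)))"

lemma sums_signature_eq_sum_monomial:
  "sums_signature l r Z a =
     (\<Sum>\<iota>\<in>increasing_tuples (cmp_rows a) (fst l) (fst r).
      \<Sum>\<kappa>\<in>increasing_tuples (cmp_cols a) (snd l) (snd r). monomial Z (mat_of_cmp a) \<iota> \<kappa>)"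
  by (simp add: sums_signature_def monomial_def cmp_rows_def cmp_cols_def)

lemma monoid_eval_empty: "monoid_eval z {#} = 1"
  by (simp add: monoid_eval_def)

lemma monoid_eval_sum: "monoid_eval z (\<Sum>i\<in>I. w i) = (\<Prod>i\<in>I. monoid_eval z (w i))"
  by (induction I rule: infinite_finite_induct) (simp_all add: monoid_eval_def)

lemma prod_lessThan_add:
  "(\<Prod>u<m + (s::nat). f u) = (\<Prod>u<m. f u) * (\<Prod>u<s. f (m + u))"
  by (induction s) (simp_all add: mult.assoc)

text \<open>The off-diagonal blocks consist of units and contribute the factor \<open>1\<close>.\<close>

lemma monomial_diag2:
  "monomial Z (diag2 A B) (append_tuple (dim_row A) (dim_row B) \<iota> \<iota>')
       (append_tuple (dim_col A) (dim_col B) \<kappa> \<kappa>') =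
     monomial Z A \<iota> \<kappa> * monomial Z B \<iota>' \<kappa>'"
  by (simp add: monomial_def diag2_def append_tuple_def prod_lessThan_add monoid_eval_empty
      prod.distrib)

text \<open>
  A factor of the monomial at position \<open>(u, v)\<close> of the block diagonal matrix depends on the tuples
  only through \<open>(p u, q v)\<close>; grouping the factors by the fibres of \<open>p\<close> and \<open>q\<close> collects the letters
  that make up one entry of the quasi-shuffled matrix.
\<close>

lemma monomial_quasi_shuffle_mat:
  assumes p: "p \<in> qSh (dim_row A) (dim_row B) j" and q: "q \<in> qSh (dim_col A) (dim_col B) k"
  shows "monomial Z (quasi_shuffle_mat A B j k p q) \<tau> \<sigma> =
    monomial Z (diag2 A B) (\<lambda>u\<in>{..<dim_row A + dim_row B}. \<tau> (p u))
      (\<lambda>v\<in>{..<dim_col A + dim_col B}. \<sigma> (q v))"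
proof -
  let ?D = "diag2 A B" and ?M = "dim_row A + dim_row B" and ?N = "dim_col A + dim_col B"
  let ?w = "\<lambda>x y u v. monoid_eval (Z (\<tau> x, \<sigma> y)) (?D $$ (u, v))"
  have grp: "(\<Prod>x<j. \<Prod>u\<in>{u. u < M \<and> p u = x}. G x u) = (\<Prod>u<M. G (p u) u)"
    if "p ` {..<M} = {..<j}" for M j :: nat and p :: "nat \<Rightarrow> nat" and G :: "nat \<Rightarrow> nat \<Rightarrow> 'b"
  proof -
    have "(\<Prod>u<M. G (p u) u) = (\<Prod>x<j. \<Prod>u\<in>{u \<in> {..<M}. p u = x}. G (p u) u)"
      using that by (intro prod.group[symmetric]) auto
    also have "\<dots> = (\<Prod>x<j. \<Prod>u\<in>{u. u < M \<and> p u = x}. G x u)"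
      by (intro prod.cong) auto
    finally show ?thesis by simp
  qed
  have pim: "p ` {..<?M} = {..<j}" and qim: "q ` {..<?N} = {..<k}"
    using p q by (auto simp: qSh_def)
  have "monomial Z (quasi_shuffle_mat A B j k p q) \<tau> \<sigma> =
      (\<Prod>x<j. \<Prod>y<k. \<Prod>u\<in>{u. u < ?M \<and> p u = x}. \<Prod>v\<in>{v. v < ?N \<and> q v = y}. ?w x y u v)"
    by (simp add: monomial_def quasi_shuffle_mat_def monoid_eval_sum)
  also have "\<dots> =
      (\<Prod>x<j. \<Prod>u\<in>{u. u < ?M \<and> p u = x}. \<Prod>y<k. \<Prod>v\<in>{v. v < ?N \<and> q v = y}. ?w x y u v)"
    by (intro prod.cong refl prod.swap)
  also have "\<dots> = (\<Prod>u<?M. \<Prod>v<?N. ?w (p u) (q v) u v)"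
    by (simp only: grp[OF pim] grp[OF qim])
  also have "\<dots> = monomial Z ?D (\<lambda>u\<in>{..<?M}. \<tau> (p u)) (\<lambda>v\<in>{..<?N}. \<sigma> (q v))"
    by (simp add: monomial_def diag2_def)
  finally show ?thesis .
qed

section \<open>The quasi-shuffle identity\<close>

lemma sums_signature_mult_eq_sum_block_tuples:
  fixes a b :: "'d cmp"
  shows "sums_signature l r Z a * sums_signature l r Z b =
     (\<Sum>g\<in>block_tuples (cmp_rows a) (cmp_rows b) (fst l) (fst r).
      \<Sum>h\<in>block_tuples (cmp_cols a) (cmp_cols b) (snd l) (snd r).
        monomial Z (diag2 (mat_of_cmp a) (mat_of_cmp b)) g h)"
proof -
  let ?A = "mat_of_cmp a" and ?B = "mat_of_cmp b"
  let ?R = "\<lambda>c :: 'd cmp. increasing_tuples (cmp_rows c) (fst l) (fst r)"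
    and ?C = "\<lambda>c :: 'd cmp. increasing_tuples (cmp_cols c) (snd l) (snd r)"
  have "sums_signature l r Z a * sums_signature l r Z b =
      (\<Sum>\<iota>\<in>?R a. \<Sum>\<iota>'\<in>?R b. \<Sum>\<kappa>\<in>?C a. \<Sum>\<kappa>'\<in>?C b. monomial Z ?A \<iota> \<kappa> * monomial Z ?B \<iota>' \<kappa>')"
    unfolding sums_signature_eq_sum_monomial sum_product ..
  also have "\<dots> = (\<Sum>\<iota>\<in>?R a. \<Sum>\<iota>'\<in>?R b. \<Sum>\<kappa>\<in>?C a. \<Sum>\<kappa>'\<in>?C b.
      monomial Z (diag2 ?A ?B) (append_tuple (cmp_rows a) (cmp_rows b) \<iota> \<iota>')
        (append_tuple (cmp_cols a) (cmp_cols b) \<kappa> \<kappa>'))"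
    by (simp add: monomial_diag2 cmp_rows_def cmp_cols_def)
  finally show ?thesis
    by (simp only: sum_append_tuple
        sum_append_tuple[where F = "\<lambda>g. sum (monomial Z (diag2 ?A ?B) g)
          (block_tuples (cmp_cols a) (cmp_cols b) (snd l) (snd r))"])
qed

lemma is_composition_mat_of_cmp: "is_composition (mat_of_cmp a)"
  using mat_of_cmp[of a] by simp

lemma mat_of_cmp_nonempty:
  assumes "a \<noteq> empty_cmp"
  shows "mat_of_cmp a \<noteq> 0\<^sub>m 0 0"
  using assms by (metis mat_of_cmp_inject mat_of_empty_cmp)

lemma sums_signature_quasi_shuffle_mat:
  assumes a: "a \<noteq> empty_cmp" and b: "b \<noteq> empty_cmp"
    and p: "p \<in> qSh (cmp_rows a) (cmp_rows b) j" and q: "q \<in> qSh (cmp_cols a) (cmp_cols b) k"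
  shows "sums_signature l r Z
      (cmp_of_mat (quasi_shuffle_mat (mat_of_cmp a) (mat_of_cmp b) j k p q)) =
    (\<Sum>\<tau>\<in>increasing_tuples j (fst l) (fst r). \<Sum>\<sigma>\<in>increasing_tuples k (snd l) (snd r).
      monomial Z (diag2 (mat_of_cmp a) (mat_of_cmp b))
        (\<lambda>u\<in>{..<cmp_rows a + cmp_rows b}. \<tau> (p u))
        (\<lambda>v\<in>{..<cmp_cols a + cmp_cols b}. \<sigma> (q v)))"
proof -
  let ?C = "quasi_shuffle_mat (mat_of_cmp a) (mat_of_cmp b) j k p q"
  have "is_composition ?C"
    using p q by (intro is_composition_quasi_shuffle_mat is_composition_mat_of_cmp
        mat_of_cmp_nonempty a b) (simp_all add: cmp_rows_def cmp_cols_def)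
  then have "mat_of_cmp (cmp_of_mat ?C) = ?C" by (simp add: cmp_of_mat_inverse)
  moreover have "dim_row ?C = j" "dim_col ?C = k" by (simp_all add: quasi_shuffle_mat_def)
  ultimately show ?thesis
    using p q by (simp add: sums_signature_eq_sum_monomial cmp_rows_def cmp_cols_def
        monomial_quasi_shuffle_mat)
qed

lemma sums_signature_mult_eq_pairing_quasi_shuffle_basis:
  "sums_signature l r Z a * sums_signature l r Z b =
     pairing (sums_signature l r Z) (quasi_shuffle_basis a b)"
proof (cases "a = empty_cmp \<or> b = empty_cmp")
  case True
  then show ?thesis
    by (auto simp: quasi_shuffle_basis_def pairing_single_1 sums_signature_empty)
next
  case False
  let ?m = "cmp_rows a" and ?s = "cmp_rows b" and ?n = "cmp_cols a" and ?t = "cmp_cols b"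
  let ?R = "\<lambda>j. increasing_tuples j (fst l) (fst r)"
    and ?C = "\<lambda>k. increasing_tuples k (snd l) (snd r)"
  let ?w = "\<lambda>p q \<tau> \<sigma>. monomial Z (diag2 (mat_of_cmp a) (mat_of_cmp b))
    (\<lambda>u\<in>{..<?m + ?s}. \<tau> (p u)) (\<lambda>v\<in>{..<?n + ?t}. \<sigma> (q v))"
  have pos: "0 < ?m + ?s" "0 < ?n + ?t"
    using is_composition_mat_of_cmp[of a] mat_of_cmp_nonempty[of a] False
    by (auto simp: is_composition_def cmp_rows_def cmp_cols_def)
  have "sums_signature l r Z a * sums_signature l r Z b =
      (\<Sum>j = 1..?m + ?s. \<Sum>p\<in>qSh ?m ?s j. \<Sum>\<tau>\<in>?R j.
       \<Sum>k = 1..?n + ?t. \<Sum>q\<in>qSh ?n ?t k. \<Sum>\<sigma>\<in>?C k. ?w p q \<tau> \<sigma>)"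
    by (simp only: sums_signature_mult_eq_sum_block_tuples
        sum_block_tuples_eq_sum_quasi_shuffles[OF pos(1)]
        sum_block_tuples_eq_sum_quasi_shuffles[OF pos(2)])
  also have "\<dots> = (\<Sum>j = 1..?m + ?s. \<Sum>p\<in>qSh ?m ?s j. \<Sum>k = 1..?n + ?t. \<Sum>\<tau>\<in>?R j.
      \<Sum>q\<in>qSh ?n ?t k. \<Sum>\<sigma>\<in>?C k. ?w p q \<tau> \<sigma>)"
    by (intro sum.cong refl sum.swap)
  also have "\<dots> = (\<Sum>j = 1..?m + ?s. \<Sum>k = 1..?n + ?t. \<Sum>p\<in>qSh ?m ?s j. \<Sum>\<tau>\<in>?R j.
      \<Sum>q\<in>qSh ?n ?t k. \<Sum>\<sigma>\<in>?C k. ?w p q \<tau> \<sigma>)"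
    by (intro sum.cong refl sum.swap)
  also have "\<dots> = (\<Sum>j = 1..?m + ?s. \<Sum>k = 1..?n + ?t. \<Sum>p\<in>qSh ?m ?s j. \<Sum>q\<in>qSh ?n ?t k.
      \<Sum>\<tau>\<in>?R j. \<Sum>\<sigma>\<in>?C k. ?w p q \<tau> \<sigma>)"
    by (intro sum.cong refl sum.swap)
  also have "\<dots> = (\<Sum>j = 1..?m + ?s. \<Sum>k = 1..?n + ?t. \<Sum>p\<in>qSh ?m ?s j. \<Sum>q\<in>qSh ?n ?t k.
      sums_signature l r Z
        (cmp_of_mat (quasi_shuffle_mat (mat_of_cmp a) (mat_of_cmp b) j k p q)))"
    using False by (intro sum.cong refl) (simp add: sums_signature_quasi_shuffle_mat)
  also have "\<dots> = pairing (sums_signature l r Z) (quasi_shuffle_basis a b)"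
    using False by (simp add: quasi_shuffle_basis_def pairing_sum pairing_single_1)
  finally show ?thesis .
qed

theorem theorem2p12:
  fixes Z :: "nat \<times> nat \<Rightarrow> 'd::finite \<Rightarrow> 'k::idom"
    and l r :: "nat \<times> nat"
    and a b :: "'d cmp"
  assumes "l \<in> {1..} \<times> {1..}" and "r \<in> {1..} \<times> {1..}"
  shows "pairing (sums_signature l r Z) (Poly_Mapping.single a 1) *
           pairing (sums_signature l r Z) (Poly_Mapping.single b 1) =
         pairing (sums_signature l r Z)
           (quasi_shuffle (Poly_Mapping.single a 1) (Poly_Mapping.single b 1))"
  unfolding pairing_single_1 quasi_shuffle_single
  by (rule sums_signature_mult_eq_pairing_quasi_shuffle_basis)

end
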